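(* Fix an injective computable enumeration $q_0,q_1,\dots$ of $\mathbb Q\cap(1,2)$. Define $u_i(k)=q_i$ for all $i,k\in\mathbb N$, and let $D=\{(i,j)\in\mathbb N^2:q_i>q_j\}$. Then there exist a set $A\subseteq\mathbb N$ with $A\le_T\emptyset'$ and a uniformly computable family of total surjective functions $h_i:\mathbb N\to\mathbb N$ ($i\in\mathbb N$) forming a profile coding for $(\{u_i\}_{i\in\mathbb N},D)$, such that, with $B_{q_i}=C_i$ where $C_i(x)=A(h_i(x))$, one has $$B_{q_i}\equiv_{\rm bfo}A\quad\text{for every }i\in\mathbb N,$$ and for all $i,j\in\mathbb N$ $$B_{q_i}<_1 B_{q_j}\quad\text{if and only if}\quad q_i<q_j.$$ Hence the $1$-degrees inside the bounded finite-one degree of $A$ contain a copy of $(\mathbb Q,\le)$.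
   Context: Sets $A\subseteq\mathbb N=\{0,1,\dots\}$ are identified with their characteristic functions: $A(x)=1$ if $x\in A$, $A(x)=0$ otherwise. $\emptyset'$ is the Turing jump of the empty set. A family of functions $h_i$ is uniformly computable if $(i,x)\mapsto h_i(x)$ is computable. For $A,B\subseteq\mathbb N$: $A\le_1 B$ means there is a total computable injective $f:\mathbb N\to\mathbb N$ with $x\in A\iff f(x)\in B$ for all $x$. $A\le_{\rm bfo}B$ means there are a total computable $f:\mathbb N\to\mathbb N$ and a constant $c\ge1$ with $x\in A\iff f(x)\in B$ for all $x$ and $|f^{-1}(y)|\le c$ for all $y$. For $r\in\{1,{\rm bfo}\}$, $A\equiv_r B$ means $A\le_r B$ and $B\le_r A$; $A<_r B$ means $A\le_r B$ and $B\not\le_r A$. The equivalence classes of $\equiv_1$ are the $1$-degrees, those of $\equiv_{\rm bfo}$ the bounded finite-one degrees. Since $\le_1$ implies $\le_{\rm bfo}$, each bounded finite-one degree is a union of $1$-degrees; these are partially ordered by $\deg_1(X)\le\deg_1(Y)\iff X\le_1 Y$. "Contains a copy of" a partial order means that there is an order-embedding (preserving and reflecting $\le$) of it into this poset. Block-density profiles are functions $u:\mathbb N\to\mathbb Q\cap(1,2)$. Given a family of profiles $\{u_i\}_{i\in\mathbb N}$ and $D\subseteq\mathbb N^2$, say that $A$ and $(h_i)_{i\in\mathbb N}$ form a profile coding for $(\{u_i\},D)$ if, with $a_0=0$, $a_{k+1}=a_k+k!$, $I_k=[a_k,a_{k+1})$ and $C_i(x)=A(h_i(x))$: (a) $A$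 is constant on each $I_k$; (b) $|h_i^{-1}(y)|\le2$ for all $i,y$; (c) $C_i\equiv_{\rm bfo}A$ for all $i$; (d) if $u_i(k)\le u_j(k)$ for all $k$, then $C_i\le_1 C_j$; (e) if $(i,j)\in D$, then $C_i\not\le_1 C_j$. *)

theory Defs
  imports Complex_Main "HOL-Library.Nat_Bijection"
begin

section \<open>Oracle computability\<close>

text \<open>
  Partial recursive functions relative to an oracle, in the one-argument presentation: tuples are
  coded by the Cantor pairing \<^const>\<open>prod_encode\<close>, so the projections and pairing replace the
  projections and the tupling of the many-argument presentation.
  With \<open>\<langle>x,y\<rangle>\<close> for the pairing, \<open>PRec p q\<close> is the \<open>f\<close> with
  \<open>f\<langle>x,0\<rangle> = p x\<close> and \<open>f\<langle>x,n+1\<rangle> = q\<langle>x,\<langle>n,f\<langle>x,n\<rangle>\<rangle>\<rangle>\<close>, and \<open>PMin p\<close> sends \<open>x\<close> to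
  the least \<open>n\<close> with \<open>p\<langle>x,n\<rangle> = 0\<close>, all \<open>p\<langle>x,m\<rangle>\<close> with \<open>m < n\<close> being defined.
\<close>

datatype prog =
    PZero | PSucc | PFst | PSnd | POracle
  | PPair prog prog | PComp prog prog | PRec prog prog | PMin prog

definition min_at :: "(nat \<rightharpoonup> nat) \<Rightarrow> nat \<Rightarrow> nat \<Rightarrow> bool" where
  "min_at f x n \<longleftrightarrow> f (prod_encode (x, n)) = Some 0 \<and>
     (\<forall>m<n. \<exists>v>0. f (prod_encode (x, m)) = Some v)"

primrec eval :: "nat set \<Rightarrow> prog \<Rightarrow> nat \<rightharpoonup> nat" where
  "eval X PZero = (\<lambda>x. Some 0)"
| "eval X PSucc = (\<lambda>x. Some (Suc x))"
| "eval X PFst = (\<lambda>x. Some (fst (prod_decode x)))"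
| "eval X PSnd = (\<lambda>x. Some (snd (prod_decode x)))"
| "eval X POracle = (\<lambda>x. Some (of_bool (x \<in> X)))"
| "eval X (PPair p q) = (\<lambda>x. Option.bind (eval X p x) (\<lambda>a.
     Option.bind (eval X q x) (\<lambda>b. Some (prod_encode (a, b)))))"
| "eval X (PComp p q) = (\<lambda>x. Option.bind (eval X q x) (eval X p))"
| "eval X (PRec p q) = (\<lambda>z. case prod_decode z of (x, n) \<Rightarrow>
     rec_nat (eval X p x)
       (\<lambda>m r. Option.bind r (\<lambda>v. eval X q (prod_encode (x, prod_encode (m, v))))) n)"
| "eval X (PMin p) = (\<lambda>x. if \<exists>n. min_at (eval X p) x n
     then Some (THE n. min_at (eval X p) x n) else None)"

primrec prog_code :: "prog \<Rightarrow> nat" where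
  "prog_code PZero = 0"
| "prog_code PSucc = 1"
| "prog_code PFst = 2"
| "prog_code PSnd = 3"
| "prog_code POracle = 4"
| "prog_code (PPair p q) = 5 + 4 * prod_encode (prog_code p, prog_code q)"
| "prog_code (PComp p q) = 6 + 4 * prod_encode (prog_code p, prog_code q)"
| "prog_code (PRec p q) = 7 + 4 * prod_encode (prog_code p, prog_code q)"
| "prog_code (PMin p) = 8 + 4 * prog_code p"

lemma min_at_unique:
  assumes "min_at f x n" "min_at f x n'"
  shows "n = n'"
  using assms unfolding min_at_def
  by (metis less_irrefl linorder_neqE_nat option.inject)

lemma inj_prog_code: "inj prog_code"
proof (rule injI)
  fix p q show "prog_code p = prog_code q \<Longrightarrow> p = q"
  proof (induction p arbitrary: q)
    case (PPair p1 p2) then show ?case by (cases q) (auto, presburger+)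
  next
    case (PComp p1 p2) then show ?case by (cases q) (auto, presburger+)
  next
    case (PRec p1 p2) then show ?case by (cases q) (auto, presburger+)
  next
    case (PMin p) then show ?case by (cases q) (auto, presburger+)
  qed (case_tac q; simp)+
qed

lemma surj_prog_code: "surj prog_code"
proof -
  have "\<exists>p. prog_code p = e" for e
  proof (induction e rule: less_induct)
    case (less e)
    show ?case
    proof (cases "e < 5")
      case True
      then have "e = 0 \<or> e = 1 \<or> e = 2 \<or> e = 3 \<or> e = 4" by linarith
      then show ?thesis by (metis prog_code.simps(1-5))
    next
      case False
      define m where "m = (e - 5) div 4"
      obtain a b where ab: "m = prod_encode (a, b)"
        by (metis prod_decode_inverse prod.exhaust)
      have m: "m < e" using False unfolding m_def by presburger
      have "a < e" "b < e"
        using le_prod_encode_1[of a b] le_prod_encode_2[of b a] m ab by linarith+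
      then obtain p q r where "prog_code p = a" "prog_code q = b" "prog_code r = m"
        using less.IH m by blast
      moreover have "e = 5 + 4 * m \<or> e = 6 + 4 * m \<or> e = 7 + 4 * m \<or> e = 8 + 4 * m"
        using False unfolding m_def by presburger
      ultimately show ?thesis using ab by (metis prog_code.simps(6-9))
    qed
  qed
  then show ?thesis by (metis surjI)
qed

text \<open>Since \<^const>\<open>prog_code\<close> is a bijection, every number is an index, and the jump is the
  diagonal halting set.\<close>

definition jump :: "nat set \<Rightarrow> nat set" where
  "jump X = {prog_code p | p. eval X p (prog_code p) \<noteq> None}"

definition turing_le :: "nat set \<Rightarrow> nat set \<Rightarrow> bool"  (infix "\<le>\<^sub>T" 50) where
  "A \<le>\<^sub>T B \<longleftrightarrow> (\<exists>p. \<forall>x. eval B p x = Some (of_bool (x \<in> A)))"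

definition computable :: "(nat \<Rightarrow> nat) \<Rightarrow> bool" where
  "computable f \<longleftrightarrow> (\<exists>p. \<forall>x. eval {} p x = Some (f x))"

definition uniformly_computable :: "(nat \<Rightarrow> nat \<Rightarrow> nat) \<Rightarrow> bool" where
  "uniformly_computable h \<longleftrightarrow> computable (\<lambda>z. case prod_decode z of (i, x) \<Rightarrow> h i x)"

definition rat_code :: "rat \<Rightarrow> nat" where
  "rat_code r = (case quotient_of r of (a, b) \<Rightarrow> prod_encode (int_encode a, int_encode b))"

section \<open>Many-one type reducibilities and their degrees\<close>

definition one_le :: "nat set \<Rightarrow> nat set \<Rightarrow> bool"  (infix "\<le>\<^sub>1" 50) where
  "A \<le>\<^sub>1 B \<longleftrightarrow> (\<exists>f. computable f \<and> inj f \<and> (\<forall>x. x \<in> A \<longleftrightarrow> f x \<in> B))"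

definition bfo_le :: "nat set \<Rightarrow> nat set \<Rightarrow> bool"  (infix "\<le>\<^sub>b\<^sub>f\<^sub>o" 50) where
  "A \<le>\<^sub>b\<^sub>f\<^sub>o B \<longleftrightarrow> (\<exists>f c. computable f \<and> 1 \<le> c \<and> (\<forall>x. x \<in> A \<longleftrightarrow> f x \<in> B) \<and>
     (\<forall>y. finite (f -` {y}) \<and> card (f -` {y}) \<le> c))"

definition one_equiv :: "nat set \<Rightarrow> nat set \<Rightarrow> bool"  (infix "\<equiv>\<^sub>1" 50) where
  "A \<equiv>\<^sub>1 B \<longleftrightarrow> A \<le>\<^sub>1 B \<and> B \<le>\<^sub>1 A"

definition bfo_equiv :: "nat set \<Rightarrow> nat set \<Rightarrow> bool"  (infix "\<equiv>\<^sub>b\<^sub>f\<^sub>o" 50) where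
  "A \<equiv>\<^sub>b\<^sub>f\<^sub>o B \<longleftrightarrow> A \<le>\<^sub>b\<^sub>f\<^sub>o B \<and> B \<le>\<^sub>b\<^sub>f\<^sub>o A"

definition one_less :: "nat set \<Rightarrow> nat set \<Rightarrow> bool"  (infix "<\<^sub>1" 50) where
  "A <\<^sub>1 B \<longleftrightarrow> A \<le>\<^sub>1 B \<and> \<not> B \<le>\<^sub>1 A"

definition one_degrees :: "nat set set set" where
  "one_degrees = UNIV // {(X, Y). X \<equiv>\<^sub>1 Y}"

definition bfo_degree :: "nat set \<Rightarrow> nat set set" where
  "bfo_degree A = {X. X \<equiv>\<^sub>b\<^sub>f\<^sub>o A}"

definition one_degree_le :: "nat set set \<Rightarrow> nat set set \<Rightarrow> bool" where
  "one_degree_le d e \<longleftrightarrow> (\<exists>X\<in>d. \<exists>Y\<in>e. X \<le>\<^sub>1 Y)"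

definition one_degrees_inside :: "nat set \<Rightarrow> nat set set set" where
  "one_degrees_inside A = {d \<in> one_degrees. d \<subseteq> bfo_degree A}"

definition contains_copy ::
  "'b set \<Rightarrow> ('b \<Rightarrow> 'b \<Rightarrow> bool) \<Rightarrow> 'a set \<Rightarrow> ('a \<Rightarrow> 'a \<Rightarrow> bool) \<Rightarrow> bool" where
  "contains_copy Q leQ P leP \<longleftrightarrow>
     (\<exists>F. F ` P \<subseteq> Q \<and> (\<forall>x\<in>P. \<forall>y\<in>P. leP x y \<longleftrightarrow> leQ (F x) (F y)))"

section \<open>Profile codings\<close>

primrec block_start :: "nat \<Rightarrow> nat" where
  "block_start 0 = 0"
| "block_start (Suc k) = block_start k + fact k"

definition block :: "nat \<Rightarrow> nat set" where
  "block k = {block_start k ..< block_start (Suc k)}"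

definition is_profile :: "(nat \<Rightarrow> rat) \<Rightarrow> bool" where
  "is_profile u \<longleftrightarrow> range u \<subseteq> {1<..<2}"

text \<open>The set \<open>C\<^sub>i\<close> with characteristic function \<open>x \<mapsto> A(h\<^sub>i(x))\<close> is the preimage \<open>h i -` A\<close>.\<close>

definition profile_coding ::
  "(nat \<Rightarrow> nat \<Rightarrow> rat) \<Rightarrow> (nat \<times> nat) set \<Rightarrow> nat set \<Rightarrow> (nat \<Rightarrow> nat \<Rightarrow> nat) \<Rightarrow> bool" where
  "profile_coding u D A h \<longleftrightarrow>
     (\<forall>i. is_profile (u i)) \<and>
     (\<forall>k. \<forall>x\<in>block k. \<forall>y\<in>block k. x \<in> A \<longleftrightarrow> y \<in> A) \<and>
     (\<forall>i y. finite (h i -` {y}) \<and> card (h i -` {y}) \<le> 2) \<and>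
     (\<forall>i. h i -` A \<equiv>\<^sub>b\<^sub>f\<^sub>o A) \<and>
     (\<forall>i j. (\<forall>k. u i k \<le> u j k) \<longrightarrow> h i -` A \<le>\<^sub>1 h j -` A) \<and>
     (\<forall>(i, j)\<in>D. \<not> h i -` A \<le>\<^sub>1 h j -` A)"

end

theory Submission
  imports Defs
begin

text \<open>
  The set \<open>A\<close> is the union of the blocks \<open>I\<^sub>k\<close> with \<open>k \<in> S\<close>, and \<open>C\<^sub>i\<close> is the same pattern with the
  \<open>k\<close>-th block stretched to length \<open>\<lfloor>q\<^sub>i k!\<rfloor>\<close>; the map \<open>h\<^sub>i\<close> wraps this block once around \<open>I\<^sub>k\<close>.
  Pointwise comparable lengths give one-one reductions block by block. If \<open>q\<^sub>i > q\<^sub>j\<close>, then for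
  large \<open>k\<close> the \<open>k\<close>-th block of \<open>C\<^sub>i\<close> is longer than the first \<open>k + 1\<close> blocks of \<open>C\<^sub>j\<close> together, since
  the factorials below \<open>k!\<close> sum to \<open>o(k!)\<close>; so an injective \<open>f\<close> sends some element of this block
  into a later block of \<open>C\<^sub>j\<close>. No requirements have to be listed: it suffices that \<open>S\<close> is
  so sparse that for every computable \<open>f\<close> there are arbitrarily large \<open>k \<in> S\<close> whose successor in \<open>S\<close>
  exceeds \<open>f\<close> on the whole \<open>k\<close>-th block, as the later block is then outside \<open>S\<close>. Such an \<open>S\<close> is
  obtained by iterating a function that is computable from the jump and dominates all computable
  functions.
\<close>

section \<open>Closure properties of the total computable functions\<close>

abbreviation pi1 :: "nat \<Rightarrow> nat" where "pi1 z \<equiv> fst (prod_decode z)"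
abbreviation pi2 :: "nat \<Rightarrow> nat" where "pi2 z \<equiv> snd (prod_decode z)"

text \<open>The common form of \<open>computable\<close> (empty oracle) and \<open>turing_le\<close>
  (0-1 valued \<open>f\<close>), so that each closure rule is proved once for both.\<close>

definition computable_in :: "nat set \<Rightarrow> (nat \<Rightarrow> nat) \<Rightarrow> bool" where
  "computable_in X f \<longleftrightarrow> (\<exists>p. \<forall>x. eval X p x = Some (f x))"

named_theorems comp_intros

lemma computable_iff: "computable f \<longleftrightarrow> computable_in {} f"
  by (simp add: computable_def computable_in_def)

lemma turing_le_iff: "A \<le>\<^sub>T X \<longleftrightarrow> computable_in X (\<lambda>x. of_bool (x \<in> A))"
  by (simp add: turing_le_def computable_in_def)

lemma computable_in_comp:
  assumes "computable_in X f" "computable_in X g"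
  shows "computable_in X (\<lambda>x. f (g x))"
proof -
  obtain p r where "\<forall>x. eval X p x = Some (f x)" "\<forall>x. eval X r x = Some (g x)"
    using assms unfolding computable_in_def by blast
  then have "\<forall>x. eval X (PComp p r) x = Some (f (g x))" by simp
  then show ?thesis unfolding computable_in_def by blast
qed

lemma computable_in_id [comp_intros]: "computable_in X (\<lambda>x. x)"
proof -
  have "\<forall>x. eval X (PPair PFst PSnd) x = Some x" by simp
  then show ?thesis unfolding computable_in_def by blast
qed

lemma computable_in_Suc [comp_intros]:
  assumes "computable_in X f" shows "computable_in X (\<lambda>x. Suc (f x))"
proof -
  have "\<forall>x. eval X PSucc x = Some (Suc x)" by simp
  then have "computable_in X Suc" unfolding computable_in_def by blast
  then show ?thesis using assms by (rule computable_in_comp)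
qed

lemma computable_in_const [comp_intros]: "computable_in X (\<lambda>x. c)"
proof (induction c)
  case 0
  have "\<forall>x. eval X PZero x = Some 0" by simp
  then show ?case unfolding computable_in_def by blast
qed (rule computable_in_Suc)

lemma computable_in_fst [comp_intros]:
  assumes "computable_in X f" shows "computable_in X (\<lambda>x. pi1 (f x))"
proof -
  have "\<forall>x. eval X PFst x = Some (pi1 x)" by simp
  then have "computable_in X pi1" unfolding computable_in_def by blast
  then show ?thesis using assms by (rule computable_in_comp)
qed

lemma computable_in_snd [comp_intros]:
  assumes "computable_in X f" shows "computable_in X (\<lambda>x. pi2 (f x))"
proof -
  have "\<forall>x. eval X PSnd x = Some (pi2 x)" by simp
  then have "computable_in X pi2" unfolding computable_in_def by blast
  then show ?thesis using assms by (rule computable_in_comp)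
qed

lemma computable_in_oracle [comp_intros]:
  assumes "computable_in X f" shows "computable_in X (\<lambda>x. of_bool (f x \<in> X))"
proof -
  have "\<forall>x. eval X POracle x = Some (of_bool (x \<in> X))" by simp
  then have "computable_in X (\<lambda>x. of_bool (x \<in> X))" unfolding computable_in_def by blast
  then show ?thesis using assms by (rule computable_in_comp)
qed

lemma computable_in_pair [comp_intros]:
  assumes "computable_in X f" "computable_in X g"
  shows "computable_in X (\<lambda>x. prod_encode (f x, g x))"
proof -
  obtain p r where "\<forall>x. eval X p x = Some (f x)" "\<forall>x. eval X r x = Some (g x)"
    using assms unfolding computable_in_def by blast
  then have "\<forall>x. eval X (PPair p r) x = Some (prod_encode (f x, g x))" by simp
  then show ?thesis unfolding computable_in_def by blast
qed

text \<open>Programs take one argument, so a binary function enters as a function of a coded pair;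
  this rule substitutes actual arguments into such a hypothesis.\<close>

lemma computable_in_comp2:
  assumes "computable_in X (\<lambda>z. F (pi1 z) (pi2 z))" "computable_in X f" "computable_in X g"
  shows "computable_in X (\<lambda>x. F (f x) (g x))"
  using computable_in_comp[OF assms(1) computable_in_pair[OF assms(2,3)]] by simp

text \<open>With a total base and a total step every stage of \<open>PRec\<close> is a
  \<open>Some\<close>, so the partial recursion collapses to plain \<open>rec_nat\<close>.\<close>

lemma computable_in_rec [comp_intros]:
  assumes "computable_in X b"
    and "computable_in X (\<lambda>w. s (pi1 w) (pi1 (pi2 w)) (pi2 (pi2 w)))"
    and "computable_in X n"
  shows "computable_in X (\<lambda>x. rec_nat (b x) (\<lambda>m v. s x m v) (n x))"
proof -
  obtain p r where p: "\<forall>x. eval X p x = Some (b x)"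
    and r: "\<forall>w. eval X r w = Some (s (pi1 w) (pi1 (pi2 w)) (pi2 (pi2 w)))"
    using assms(1,2) unfolding computable_in_def by blast
  have "rec_nat (eval X p x)
      (\<lambda>m r'. Option.bind r' (\<lambda>v. eval X r (prod_encode (x, prod_encode (m, v))))) k
    = Some (rec_nat (b x) (\<lambda>m v. s x m v) k)" for x k
    by (induction k) (simp_all add: p r)
  then have "\<forall>z. eval X (PRec p r) z = Some (rec_nat (b (pi1 z)) (\<lambda>m v. s (pi1 z) m v) (pi2 z))"
    by (simp add: case_prod_beta)
  then have "computable_in X (\<lambda>z. rec_nat (b (pi1 z)) (\<lambda>m v. s (pi1 z) m v) (pi2 z))"
    unfolding computable_in_def by blast
  then show ?thesis
    by (rule computable_in_comp2[where F = "\<lambda>x k. rec_nat (b x) (\<lambda>m v. s x m v) k"])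
      (rule computable_in_id assms(3))+
qed

lemma computable_in_add [comp_intros]:
  assumes "computable_in X f" "computable_in X g"
  shows "computable_in X (\<lambda>x. f x + g x)"
proof -
  have "rec_nat a (\<lambda>_ v. Suc v) b = a + b" for a b :: nat by (induction b) auto
  then have "(\<lambda>x. f x + g x) = (\<lambda>x. rec_nat (f x) (\<lambda>_ v. Suc v) (g x))" by simp
  then show ?thesis by (auto intro!: comp_intros assms)
qed

lemma computable_in_mult [comp_intros]:
  assumes "computable_in X f" "computable_in X g"
  shows "computable_in X (\<lambda>x. f x * g x)"
proof -
  have "rec_nat 0 (\<lambda>_ v. v + a) b = a * b" for a b :: nat by (induction b) auto
  then have "(\<lambda>x. f x * g x) = (\<lambda>x. rec_nat 0 (\<lambda>_ v. v + f x) (g x))" by simp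
  then show ?thesis by (auto intro!: comp_intros computable_in_comp[of X f] assms)
qed

lemma computable_in_diff [comp_intros]:
  assumes "computable_in X f" "computable_in X g"
  shows "computable_in X (\<lambda>x. f x - g x)"
proof -
  \<comment> \<open>A recursion step that returns the counter and ignores the previous value yields
    the predecessor.\<close>
  have *: "rec_nat 0 (\<lambda>m _. m) b = b - 1" for b :: nat by (cases b) auto
  have pred: "computable_in X (\<lambda>x. k x - 1)" if "computable_in X k" for k
  proof -
    have "computable_in X (\<lambda>x. rec_nat 0 (\<lambda>m _. m) (k x))" by (intro comp_intros that)
    with * show ?thesis by simp
  qed
  have "rec_nat a (\<lambda>_ v. v - 1) b = a - b" for a b :: nat by (induction b) auto
  then have "(\<lambda>x. f x - g x) = (\<lambda>x. rec_nat (f x) (\<lambda>_ v. v - 1) (g x))" by simp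
  moreover have "computable_in X (\<lambda>x. rec_nat (f x) (\<lambda>_ v. v - 1) (g x))"
    by (rule computable_in_rec assms pred computable_in_snd computable_in_id)+
  ultimately show ?thesis by simp
qed

lemma computable_in_less [comp_intros]:
  assumes "computable_in X f" "computable_in X g"
  shows "computable_in X (\<lambda>x. of_bool (f x < g x))"
proof -
  have "(\<lambda>x. of_bool (f x < g x)) = (\<lambda>x. 1 - (1 - (g x - f x)))" by auto
  then show ?thesis by (auto intro!: comp_intros assms)
qed

lemma computable_in_eq [comp_intros]:
  assumes "computable_in X f" "computable_in X g"
  shows "computable_in X (\<lambda>x. of_bool (f x = g x))"
proof -
  have "(\<lambda>x. of_bool (f x = g x)) = (\<lambda>x. 1 - ((f x - g x) + (g x - f x)))" by auto
  then show ?thesis by (auto intro!: comp_intros assms)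
qed

lemma computable_in_not [comp_intros]:
  assumes "computable_in X (\<lambda>x. of_bool (P x))"
  shows "computable_in X (\<lambda>x. of_bool (\<not> P x))"
proof -
  have "(\<lambda>x. of_bool (\<not> P x)) = (\<lambda>x. 1 - (of_bool (P x) :: nat))" by auto
  then show ?thesis by (auto intro!: comp_intros assms)
qed

lemma computable_in_if [comp_intros]:
  assumes "computable_in X (\<lambda>x. of_bool (P x))" "computable_in X f" "computable_in X g"
  shows "computable_in X (\<lambda>x. if P x then f x else g x)"
proof -
  have "(\<lambda>x. if P x then f x else g x) = (\<lambda>x. of_bool (P x) * f x + of_bool (\<not> P x) * g x)"
    by auto
  then show ?thesis by (auto intro!: comp_intros assms)
qed

lemma computable_in_sum [comp_intros]:
  assumes "computable_in X (\<lambda>z. l (pi1 z) (pi2 z))" "computable_in X n"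
  shows "computable_in X (\<lambda>x. \<Sum>m<n x. l x m)"
proof -
  have "rec_nat 0 (\<lambda>m v. v + l x m) k = (\<Sum>m<k. l x m)" for x k by (induction k) auto
  then have "(\<lambda>x. \<Sum>m<n x. l x m) = (\<lambda>x. rec_nat 0 (\<lambda>m v. v + l x m) (n x))" by simp
  then show ?thesis by (auto intro!: comp_intros computable_in_comp2[OF assms(1)] assms(2))
qed

lemma computable_in_all_less [comp_intros]:
  assumes "computable_in X (\<lambda>z. of_bool (P (pi1 z) (pi2 z)))" "computable_in X n"
  shows "computable_in X (\<lambda>x. of_bool (\<forall>m<n x. P x m))"
proof -
  have *: "rec_nat 1 (\<lambda>m v. v * of_bool (P x m)) k = (of_bool (\<forall>m<k. P x m) :: nat)" for x k
    by (induction k) (auto simp: less_Suc_eq)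
  have "(\<lambda>x. of_bool (\<forall>m<n x. P x m)) = (\<lambda>x. rec_nat (1::nat) (\<lambda>m v. v * of_bool (P x m)) (n x))"
    by (simp only: *)
  then show ?thesis
    by (auto intro!: comp_intros assms(2) computable_in_comp2[OF assms(1)])
qed

text \<open>\<open>PMin\<close> looks for the value 0, so the searched program decides the negation
  of \<open>P\<close>; its totality supplies the definedness demanded by
  \<open>min_at\<close>.\<close>

lemma eval_PMin:
  assumes "\<And>x n. eval X p (prod_encode (x, n)) = Some (of_bool (\<not> P x n))"
  shows "eval X (PMin p) x = (if \<exists>n. P x n then Some (LEAST n. P x n) else None)"
proof -
  have iff: "min_at (eval X p) x n \<longleftrightarrow> P x n \<and> (\<forall>m<n. \<not> P x m)" for n
    unfolding min_at_def by (auto simp: assms)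
  show ?thesis
  proof (cases "\<exists>n. P x n")
    case True
    have "min_at (eval X p) x (LEAST n. P x n)"
      unfolding iff using LeastI_ex[OF True] not_less_Least by blast
    then have "(THE n. min_at (eval X p) x n) = (LEAST n. P x n)" "\<exists>n. min_at (eval X p) x n"
      by (blast intro: min_at_unique)+
    with True show ?thesis by simp
  qed (simp add: iff)
qed

lemma computable_in_Least:
  assumes "computable_in X (\<lambda>z. of_bool (P (pi1 z) (pi2 z)))" "\<And>x. \<exists>n. P x n"
  shows "computable_in X (\<lambda>x. LEAST n. P x n)"
proof -
  obtain p where "\<And>z. eval X p z = Some (of_bool (\<not> P (pi1 z) (pi2 z)))"
    using computable_in_not[OF assms(1)] unfolding computable_in_def by auto
  then have "\<forall>x. eval X (PMin p) x = Some (LEAST n. P x n)"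
    using eval_PMin[of X p P] assms(2) by simp
  then show ?thesis unfolding computable_in_def by blast
qed

lemma computable_in_fact [comp_intros]:
  assumes "computable_in X f" shows "computable_in X (\<lambda>x. fact (f x))"
proof -
  have "rec_nat 1 (\<lambda>m v. Suc m * v) n = fact n" for n by (induction n) auto
  then have "(\<lambda>x. fact (f x)) = (\<lambda>x. rec_nat 1 (\<lambda>m v. Suc m * v) (f x))" by simp
  then show ?thesis by (auto intro!: comp_intros assms simp del: mult_Suc)
qed

section \<open>A function below the jump that dominates every computable function\<close>

text \<open>Divergence at 0 is the purpose: it turns a comparison of values into a halting question,
  which the jump answers. An unbounded search for \<open>n\<close> with \<open>x = Suc n\<close>
  achieves it.\<close>

lemma ex_prog_predecessor:
  obtains p where "eval X p 0 = None" "\<And>v. eval X p (Suc v) = Some v"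
proof -
  have "computable_in X (\<lambda>z. of_bool (\<not> pi1 z = Suc (pi2 z)))" by (intro comp_intros)
  then obtain p where "\<And>z. eval X p z = Some (of_bool (\<not> pi1 z = Suc (pi2 z)))"
    unfolding computable_in_def by blast
  then have "eval X (PMin p) x = (if \<exists>n. x = Suc n then Some (LEAST n. x = Suc n) else None)" for x
    by (intro eval_PMin) simp
  then show ?thesis by (intro that[of "PMin p"]) (auto intro: Least_equality)
qed

lemma jump_iff: "prog_code p \<in> jump X \<longleftrightarrow> eval X p (prog_code p) \<noteq> None"
  unfolding jump_def using inj_prog_code by (auto dest: injD)

text \<open>No universal program is needed: if \<open>d\<close> computes the partial predecessor, then composing
  \<open>y\<close> copies of \<open>d\<close> after \<open>p\<close> halts exactly when \<open>p\<close> halts with a value at least \<open>y\<close>, so the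
  jump can bound the values of \<open>p\<close>.\<close>

lemma ex_dominating:
  obtains H where "computable_in (jump {}) H"
    and "\<And>p n v. prog_code p \<le> n \<Longrightarrow> eval {} p 0 = Some v \<Longrightarrow> v < H n"
proof -
  obtain d where d: "eval {} d 0 = None" "\<And>v. eval {} d (Suc v) = Some v"
    using ex_prog_predecessor by blast
  \<comment> \<open>\<open>PComp p PZero\<close> discards the input, so running the program on its
    own code, as the jump does, amounts to running \<open>p\<close> at 0.\<close>
  define r where "r p = rec_nat (PComp p PZero) (\<lambda>_. PComp d)" for p
  \<comment> \<open>The same recursion on codes, which makes the queries to the jump computable:
    \<open>6 + 4 * ...\<close> is the code of a \<open>PComp\<close>, and 0 that of
    \<open>PZero\<close>.\<close>
  define c where "c z = rec_nat (6 + 4 * prod_encode (z, 0))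
    (\<lambda>_ v. 6 + 4 * prod_encode (prog_code d, v))" for z
  have code: "prog_code (r p y) = c (prog_code p) y" for p y
    unfolding r_def c_def by (induction y) auto
  have "eval {} (r p y) x = (case eval {} p 0 of None \<Rightarrow> None
      | Some v \<Rightarrow> if y \<le> v then Some (v - y) else None)" for p y x
  proof (induction y)
    case 0
    show ?case by (auto simp: r_def split: option.splits)
  next
    case (Suc y)
    have "eval {} (r p (Suc y)) x = Option.bind (eval {} (r p y) x) (eval {} d)"
      by (simp add: r_def)
    moreover have "eval {} d (v - y) = (if Suc y \<le> v then Some (v - Suc y) else None)" for v
    proof (cases "v - y")
      case 0
      then show ?thesis using d(1) by simp
    next
      case (Suc w)
      then have "Suc y \<le> v" "w = v - Suc y" by linarith+
      with Suc d(2) show ?thesis by simp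
    qed
    ultimately show ?case using Suc d(1) by (auto split: option.splits)
  qed
  then have mem: "c (prog_code p) y \<in> jump {} \<longleftrightarrow> (\<exists>v. eval {} p 0 = Some v \<and> y \<le> v)" for p y
    unfolding code[symmetric] jump_iff by (auto split: option.splits)
  \<comment> \<open>By \<open>mem\<close>, this says that no program with code at most
    \<open>n\<close> outputs a value of \<open>y\<close> or more at 0.\<close>
  define P where "P n y \<longleftrightarrow> (\<forall>z<Suc n. \<not> c z y \<in> jump {})" for n y
  have ex: "\<exists>y. P n y" for n
  proof -
    \<comment> \<open>Demanding this for all \<open>y' \<ge> y\<close> lets the bounds for single
      codes be merged by \<open>max\<close>.\<close>
    have "\<exists>y. \<forall>z<m. \<forall>y'\<ge>y. \<not> c z y' \<in> jump {}" for m
    proof (induction m)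
      case (Suc m)
      then obtain y where y: "\<forall>z<m. \<forall>y'\<ge>y. \<not> c z y' \<in> jump {}" by blast
      obtain p where p: "prog_code p = m" using surj_prog_code by (metis surjD)
      obtain y2 where "\<forall>y'\<ge>y2. \<not> c m y' \<in> jump {}"
      proof (cases "eval {} p 0")
        case None
        then show ?thesis using that[of 0] mem[of p] p by simp
      next
        case (Some v)
        then show ?thesis using that[of "Suc v"] mem[of p] p by auto
      qed
      with y have "\<forall>z<Suc m. \<forall>y'\<ge>max y y2. \<not> c z y' \<in> jump {}" by (auto simp: less_Suc_eq)
      then show ?case by blast
    qed simp
    then show ?thesis unfolding P_def by blast
  qed
  define H where "H n = (LEAST y. P n y)" for n
  have "computable_in (jump {}) H"
    unfolding H_def
    by (rule computable_in_Least[OF _ ex]) (unfold P_def c_def, intro comp_intros)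
  moreover have "v < H n" if "prog_code p \<le> n" "eval {} p 0 = Some v" for p n v
  proof -
    have "P n (H n)" unfolding H_def using ex by (rule LeastI_ex)
    then have "\<not> c (prog_code p) (H n) \<in> jump {}" using that(1) unfolding P_def by auto
    then show ?thesis using mem[of p "H n"] that(2) by auto
  qed
  ultimately show thesis by (rule that)
qed

section \<open>A set below the jump with gaps beyond every computable function\<close>

primrec const_prog :: "nat \<Rightarrow> prog" where
  "const_prog 0 = PZero"
| "const_prog (Suc n) = PComp PSucc (const_prog n)"

lemma eval_const_prog [simp]: "eval X (const_prog n) x = Some n"
  by (induction n) auto

lemma prod_encode_mono: "a \<le> a' \<Longrightarrow> b \<le> b' \<Longrightarrow> prod_encode (a, b) \<le> prod_encode (a', b')"
  unfolding prod_encode_def triangle_def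
  by (auto intro!: add_mono div_le_mono mult_le_mono)

text \<open>The dominating function bounds values at 0 only, so an argument \<open>x\<close> is
  hard-wired by composing with \<open>const_prog x\<close>. Monotonicity bounds the codes for all
  \<open>x \<le> b k\<close> by the one for \<open>b k\<close>.\<close>

lemma mono_const_prog_code: "mono (\<lambda>n. prog_code (const_prog n))"
proof (rule mono_iff_le_Suc[THEN iffD2], rule allI)
  fix n
  show "prog_code (const_prog n) \<le> prog_code (const_prog (Suc n))"
    using le_prod_encode_2[of "prog_code (const_prog n)" 1] by simp
qed

lemma computable_in_const_prog_code [comp_intros]:
  assumes "computable_in X f" shows "computable_in X (\<lambda>x. prog_code (const_prog (f x)))"
proof -
  \<comment> \<open>1 is the code of \<open>PSucc\<close>, so the step passes from the code of a
    program to that of its composition with \<open>PSucc\<close>.\<close>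
  have "rec_nat 0 (\<lambda>_ v. 6 + 4 * prod_encode (1, v)) n = prog_code (const_prog n)" for n
    by (induction n) auto
  then have "(\<lambda>x. prog_code (const_prog (f x)))
      = (\<lambda>x. rec_nat 0 (\<lambda>_ v. 6 + 4 * prod_encode (1, v)) (f x))" by simp
  moreover have "computable_in X (\<lambda>x. rec_nat 0 (\<lambda>_ v. 6 + 4 * prod_encode (1, v)) (f x))"
    by (intro comp_intros assms)
  ultimately show ?thesis by simp
qed

text \<open>After each \<open>k\<close> in \<open>S\<close> the next element is placed beyond
  \<open>H\<close> at a bound for the codes of all programs that apply a program of code at most
  \<open>k\<close> to a constant at most \<open>b k\<close>. So every \<open>k\<close> in
  \<open>S\<close> above a code of \<open>f\<close> works for \<open>f\<close>.\<close>

lemma ex_sparse_set: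
  assumes b: "computable_in (jump {}) b"
  obtains S where "computable_in (jump {}) (\<lambda>k. of_bool (k \<in> S))"
    and "\<And>f n. computable f \<Longrightarrow>
      \<exists>k\<in>S. n \<le> k \<and> (\<forall>x\<le>b k. \<forall>m. k < m \<and> m \<le> f x \<longrightarrow> m \<notin> S)"
proof -
  obtain H where H: "computable_in (jump {}) H"
    and dom: "\<And>p n v. prog_code p \<le> n \<Longrightarrow> eval {} p 0 = Some v \<Longrightarrow> v < H n"
    using ex_dominating by blast
  \<comment> \<open>The code of the program with code \<open>k\<close> composed with
    \<open>const_prog (b k)\<close>; as pairing is monotone, it bounds the codes built from smaller
    components.\<close>
  define B where "B k = 6 + 4 * prod_encode (k, prog_code (const_prog (b k)))" for k
  \<comment> \<open>\<open>N k\<close> is the least element of \<open>S\<close> not below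
    \<open>k\<close>; once the counter reaches it, a new target is set. Reading off \<open>S\<close>
    as the fixed points of \<open>N\<close> makes membership decidable from the jump.\<close>
  define N where "N = rec_nat 0 (\<lambda>k v. if k = v then Suc k + H (B k) else v)"
  have N0: "N 0 = 0" and N_Suc: "N (Suc k) = (if k = N k then Suc k + H (B k) else N k)" for k
    by (auto simp: N_def)
  define S where "S = {k. N k = k}"
  have ge: "k \<le> N k" for k by (induction k) (auto simp: N0 N_Suc)
  have stable: "N m = N n" if "n \<le> m" "m \<le> N n" for n m
    using that by (induction m rule: dec_induct) (auto simp: N_Suc)
  have "computable_in (jump {}) (\<lambda>k. of_bool (N k = k))"
    unfolding N_def B_def by (intro comp_intros computable_in_comp[OF H] computable_in_comp[OF b])
  then have 1: "computable_in (jump {}) (\<lambda>k. of_bool (k \<in> S))" by (simp add: S_def)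
  have 2: "\<exists>k\<in>S. n \<le> k \<and> (\<forall>x\<le>b k. \<forall>m. k < m \<and> m \<le> f x \<longrightarrow> m \<notin> S)"
    if f: "computable f" for f n
  proof -
    obtain p where p: "\<forall>x. eval {} p x = Some (f x)" using f unfolding computable_def by blast
    \<comment> \<open>Starting from the maximum gives an element of \<open>S\<close> above both
      \<open>n\<close> and a code of \<open>f\<close>.\<close>
    define k where "k = N (max n (prog_code p))"
    have k: "n \<le> k" "prog_code p \<le> k" using ge[of "max n (prog_code p)"] by (auto simp: k_def)
    have "N k = k" unfolding k_def by (rule stable) (use ge in auto)
    then have Nm: "N m = Suc k + H (B k)" if "k < m" "m \<le> Suc k + H (B k)" for m
      using stable[of "Suc k" m] that by (simp add: N_Suc)
    have "m \<notin> S" if "x \<le> b k" "k < m" "m \<le> f x" for x m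
    proof -
      have "prog_code (PComp p (const_prog x)) \<le> B k"
        using k(2) monoD[OF mono_const_prog_code that(1)] by (simp add: B_def prod_encode_mono)
      then have "f x < H (B k)" by (rule dom) (simp add: p)
      then show ?thesis using that Nm[of m] by (auto simp: S_def)
    qed
    then show ?thesis using k(1) \<open>N k = k\<close> by (auto simp: S_def)
  qed
  show thesis using that[OF 1 2] .
qed

section \<open>Consecutive blocks of prescribed lengths\<close>

definition start :: "(nat \<Rightarrow> nat) \<Rightarrow> nat \<Rightarrow> nat" where
  "start l k = (\<Sum>m<k. l m)"

text \<open>A least-number search, so that \<open>computable_in_Least\<close> applies.\<close>

definition index :: "(nat \<Rightarrow> nat) \<Rightarrow> nat \<Rightarrow> nat" where
  "index l x = (LEAST k. x < start l (Suc k))"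

lemma start_Suc: "start l (Suc k) = start l k + l k"
  by (simp add: start_def)

lemma start_mono: "j \<le> k \<Longrightarrow> start l j \<le> start l k"
  unfolding start_def by (rule sum_mono2) auto

lemma start_pointwise_mono: "(\<And>k. l k \<le> l' k) \<Longrightarrow> start l k \<le> start l' k"
  unfolding start_def by (rule sum_mono)

lemma block_start_eq: "block_start k = start fact k"
  by (induction k) (auto simp: start_def)

context
  fixes l :: "nat \<Rightarrow> nat"
  assumes pos: "\<And>k. 0 < l k"
begin

lemma le_start: "k \<le> start l k"
proof (induction k)
  case (Suc k)
  then show ?case using pos[of k] by (simp add: start_Suc)
qed simp

lemma ex_less_start: "\<exists>k. x < start l (Suc k)"
  using le_start[of "Suc x"] by (auto simp: Suc_le_eq)

lemma less_start_index: "x < start l (Suc (index l x))"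
  unfolding index_def by (rule LeastI_ex) (rule ex_less_start)

lemma start_index_le: "start l (index l x) \<le> x"
proof (cases "index l x")
  case (Suc k)
  then have "\<not> x < start l (Suc k)"
    unfolding index_def by (intro not_less_Least) simp
  then show ?thesis by (simp add: Suc)
qed (simp add: start_def)

lemma index_unique: "start l k \<le> x \<Longrightarrow> x < start l (Suc k) \<Longrightarrow> index l x = k"
  unfolding index_def
proof (rule Least_equality)
  fix y assume x: "start l k \<le> x" "x < start l (Suc y)"
  show "k \<le> y"
  proof (rule ccontr)
    assume "\<not> k \<le> y"
    then have "start l (Suc y) \<le> start l k" by (intro start_mono) simp
    with x show False by simp
  qed
qed

lemma index_eq_iff: "index l x = k \<longleftrightarrow> start l k \<le> x \<and> x < start l (Suc k)"
  using index_unique start_index_le less_start_index by blast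

lemma index_start_add: "t < l k \<Longrightarrow> index l (start l k + t) = k"
  by (rule index_unique) (auto simp: start_Suc)

lemma offset_less: "x - start l (index l x) < l (index l x)"
  using less_start_index[of x] start_index_le[of x] by (auto simp: start_Suc)

lemma index_le: "index l x \<le> x"
  using le_start start_index_le le_trans by blast

end

lemma block_eq: "block k = {x. index fact x = k}"
  by (auto simp: block_def index_eq_iff block_start_eq simp del: block_start.simps(2))

lemma computable_in_start [comp_intros]:
  assumes "computable_in X (\<lambda>z. l (pi1 z) (pi2 z))" "computable_in X n"
  shows "computable_in X (\<lambda>x. start (l x) (n x))"
  unfolding start_def by (intro comp_intros assms)

lemma computable_in_index:
  assumes "computable_in X (\<lambda>z. l (pi1 z) (pi2 z))" "computable_in X f" "\<And>x k. 0 < l x k"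
  shows "computable_in X (\<lambda>x. index (l x) (f x))"
  unfolding index_def
proof (rule computable_in_Least)
  show "computable_in X (\<lambda>z. of_bool (f (pi1 z) < start (l (pi1 z)) (Suc (pi2 z))))"
    by (intro comp_intros computable_in_comp[OF assms(2)] computable_in_comp2[OF assms(1)])
  show "\<exists>k. f x < start (l x) (Suc k)" for x
    using assms(3) by (rule ex_less_start)
qed

section \<open>Sets repeating a pattern along blocks, and their one-one comparison\<close>

definition coded :: "nat set \<Rightarrow> (nat \<Rightarrow> nat) \<Rightarrow> nat set" where
  "coded S l = {x. index l x \<in> S}"

text \<open>Keeping the offset, the \<open>k\<close>-th block of lengths \<open>l\<close> maps onto
  an initial segment of the \<open>k\<close>-th block of lengths \<open>l'\<close>; the block
  number, and hence membership, is preserved.\<close>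

lemma coded_one_le:
  assumes "computable l" "computable l'" "\<And>k. 0 < l k" "\<And>k. l k \<le> l' k"
  shows "coded S l \<le>\<^sub>1 coded S l'"
proof -
  define f where "f x = start l' (index l x) + (x - start l (index l x))" for x
  have pos': "0 < l' k" for k using assms(3,4) by (rule less_le_trans)
  have ix: "index l' (f x) = index l x" for x
    unfolding f_def
    using pos' less_le_trans[OF offset_less[of l, OF assms(3)] assms(4)] by (rule index_start_add)
  have "inj f"
  proof (rule injI)
    fix x y assume "f x = f y"
    moreover from this have "index l x = index l y" using ix by metis
    ultimately show "x = y"
      using start_index_le[of l x, OF assms(3)] start_index_le[of l y, OF assms(3)]
      unfolding f_def by simp
  qed
  moreover have "computable f"
    unfolding f_def computable_iff
    by (intro comp_intros computable_in_index computable_in_comp[OF assms(1)[unfolded computable_iff]]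
        computable_in_comp[OF assms(2)[unfolded computable_iff]] assms(3))
  ultimately show ?thesis unfolding one_le_def coded_def using ix by auto
qed

text \<open>Pigeonhole: an injective reduction cannot squeeze the \<open>k\<close>-th block into the
  first \<open>k + 1\<close> blocks of lengths \<open>l'\<close>, so some point of it lands in a
  later block, whose number the gap excludes from \<open>S\<close>. The gap concerns arguments up to
  \<open>b k\<close>, so \<open>b k\<close> has to bound the end of the block.\<close>

lemma not_coded_one_le:
  assumes S: "\<And>f n. computable f \<Longrightarrow>
      \<exists>k\<in>S. n \<le> k \<and> (\<forall>x\<le>b k. \<forall>m. k < m \<and> m \<le> f x \<longrightarrow> m \<notin> S)"
    and pos: "\<And>k. 0 < l k" "\<And>k. 0 < l' k"
    and b: "\<And>k. start l (Suc k) \<le> b k"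
    and large: "\<And>k. n \<le> k \<Longrightarrow> start l' (Suc k) < l k"
  shows "\<not> coded S l \<le>\<^sub>1 coded S l'"
proof
  assume "coded S l \<le>\<^sub>1 coded S l'"
  then obtain f where f: "computable f" "inj f" "\<And>x. index l x \<in> S \<longleftrightarrow> index l' (f x) \<in> S"
    unfolding one_le_def coded_def by auto
  obtain k where k: "k \<in> S" "n \<le> k"
    and gap: "\<And>x m. x \<le> b k \<Longrightarrow> k < m \<Longrightarrow> m \<le> f x \<Longrightarrow> m \<notin> S"
    using S[OF f(1)] by blast
  let ?J = "{start l k..<start l (Suc k)}"
  have "\<not> f ` ?J \<subseteq> {..<start l' (Suc k)}"
  proof
    assume "f ` ?J \<subseteq> {..<start l' (Suc k)}"
    then have "card ?J \<le> card {..<start l' (Suc k)}"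
      by (intro card_inj_on_le[of f]) (use f(2) in \<open>auto intro: inj_on_subset\<close>)
    then show False using large[OF k(2)] by (simp add: start_Suc)
  qed
  then obtain x where x: "x \<in> ?J" "start l' (Suc k) \<le> f x"
    by (meson image_subsetI lessThan_iff not_less)
  have "index l x = k" using x(1) by (intro index_unique pos) auto
  then have "index l' (f x) \<in> S" using f(3)[of x] k(1) by simp
  moreover have "k < index l' (f x)"
    using x(2) less_start_index[of l', OF pos(2), of "f x"] start_mono[of "Suc (index l' (f x))" "Suc k" l']
    by (meson leI le_less_trans not_less Suc_le_mono le_trans)
  moreover have "x \<le> b k" using x(1) b[of k] by auto
  \<comment> \<open>A block number is at most any point of its block, so the later block number lies
    in the gap between \<open>k\<close> and \<open>f x\<close>.\<close>
  ultimately show False using gap index_le[of l', OF pos(2), of "f x"] by blast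
qed

section \<open>Folding stretched blocks back onto the factorial blocks\<close>

definition fold_map :: "(nat \<Rightarrow> nat) \<Rightarrow> nat \<Rightarrow> nat" where
  "fold_map l x = start fact (index l x) +
     (if x - start l (index l x) < fact (index l x) then x - start l (index l x)
      else x - start l (index l x) - fact (index l x))"

context
  fixes l :: "nat \<Rightarrow> nat"
  assumes lower: "\<And>k. fact k \<le> l k" and upper: "\<And>k. l k \<le> 2 * fact k"
begin

lemma length_pos: "0 < l k"
  using lower[of k] fact_gt_zero[of k] by (metis less_le_trans)

text \<open>By \<open>upper\<close> every offset is below twice the factorial, so a single
  subtraction brings it into the factorial block.\<close>

lemma index_fold_map: "index fact (fold_map l x) = index l x"
proof -
  have "x - start l (index l x) < 2 * fact (index l x)"
    using offset_less[of l, OF length_pos] upper by (metis less_le_trans)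
  then show ?thesis
    unfolding fold_map_def by (intro index_start_add) auto
qed

lemma vimage_fold_map: "fold_map l -` coded S fact = coded S l"
  by (auto simp: coded_def index_fold_map)

text \<open>By \<open>lower\<close> each block begins with a full copy of the factorial block, on
  which folding is a translation; preimages are chosen there.\<close>

lemma surj_fold_map: "surj (fold_map l)"
proof (rule surjI)
  fix y :: nat
  let ?k = "index fact y"
  have t: "y - start fact ?k < fact ?k" by (rule offset_less) simp
  have "index l (start l ?k + (y - start fact ?k)) = ?k"
    by (rule index_start_add) (use length_pos lower t in \<open>auto intro: less_le_trans\<close>)
  then show "fold_map l (start l ?k + (y - start fact ?k)) = y"
    using t start_index_le[of fact y] by (simp add: fold_map_def)
qed

text \<open>Folding keeps the block number, so a point has at most one preimage in the first copy
  and one in the overhang, a factorial further on.\<close>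

lemma fold_map_fibre:
  "finite (fold_map l -` {y}) \<and> card (fold_map l -` {y}) \<le> 2"
proof -
  let ?k = "index fact y"
  let ?s = "start l ?k + (y - start fact ?k)"
  have sub: "fold_map l -` {y} \<subseteq> {?s, ?s + fact ?k}"
  proof
    fix x assume "x \<in> fold_map l -` {y}"
    then have y: "fold_map l x = y" by simp
    then have "index l x = ?k" using index_fold_map by metis
    moreover have "start l (index l x) \<le> x" by (rule start_index_le[OF length_pos])
    ultimately show "x \<in> {?s, ?s + fact ?k}"
      using y unfolding fold_map_def by (auto split: if_splits)
  qed
  moreover have "card {?s, ?s + fact ?k} \<le> 2" by (simp add: card_insert_if)
  ultimately show ?thesis by (meson card_mono finite.emptyI finite.insertI finite_subset le_trans)
qed

end

lemma computable_in_fold_map: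
  assumes "computable_in X (\<lambda>z. l (pi1 z) (pi2 z))" "computable_in X f" "\<And>x k. 0 < l x k"
  shows "computable_in X (\<lambda>x. fold_map (l x) (f x))"
  unfolding fold_map_def
  by (intro comp_intros computable_in_index assms)

section \<open>Reducibilities\<close>

lemma one_le_refl: "A \<le>\<^sub>1 A"
  unfolding one_le_def computable_iff
  by (intro exI[of _ "\<lambda>x. x"]) (simp add: computable_in_id)

lemma one_le_trans: "A \<le>\<^sub>1 B \<Longrightarrow> B \<le>\<^sub>1 C \<Longrightarrow> A \<le>\<^sub>1 C"
proof -
  assume "A \<le>\<^sub>1 B" "B \<le>\<^sub>1 C"
  then obtain f g where fg: "computable f" "inj f" "\<forall>x. x \<in> A \<longleftrightarrow> f x \<in> B"
    "computable g" "inj g" "\<forall>x. x \<in> B \<longleftrightarrow> g x \<in> C"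
    unfolding one_le_def by blast
  have "computable (\<lambda>x. g (f x))"
    using fg(4,1) unfolding computable_iff by (rule computable_in_comp)
  moreover have "inj (\<lambda>x. g (f x))"
    using inj_compose[OF fg(5,2)] by (simp add: comp_def)
  ultimately show ?thesis unfolding one_le_def using fg(3,6) by blast
qed

lemma one_le_imp_bfo_le:
  assumes "A \<le>\<^sub>1 B" shows "A \<le>\<^sub>b\<^sub>f\<^sub>o B"
proof -
  obtain f where f: "computable f" "inj f" "\<forall>x. x \<in> A \<longleftrightarrow> f x \<in> B"
    using assms unfolding one_le_def by blast
  have "finite (f -` {y}) \<and> card (f -` {y}) \<le> 1" for y
  proof
    show "finite (f -` {y})" using f(2) by (intro finite_vimageI) simp_all
    have "inj_on f (f -` {y})" using f(2) by (rule inj_on_subset) simp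
    then show "card (f -` {y}) \<le> 1" using card_inj_on_le[of f "f -` {y}" "{y}"] by auto
  qed
  with f show ?thesis unfolding bfo_le_def by (intro exI[of _ f] exI[of _ 1]) simp
qed

text \<open>A fibre of the composition is a union of at most \<open>d\<close> fibres of size at most
  \<open>c\<close>, whence the constant \<open>d * c\<close>.\<close>

lemma bfo_le_trans:
  assumes "A \<le>\<^sub>b\<^sub>f\<^sub>o B" "B \<le>\<^sub>b\<^sub>f\<^sub>o C" shows "A \<le>\<^sub>b\<^sub>f\<^sub>o C"
proof -
  obtain f c where f: "computable f" "1 \<le> c" "\<forall>x. x \<in> A \<longleftrightarrow> f x \<in> B"
    "\<And>y. finite (f -` {y}) \<and> card (f -` {y}) \<le> c"
    using assms(1) unfolding bfo_le_def by blast
  obtain g d where g: "computable g" "1 \<le> d" "\<forall>x. x \<in> B \<longleftrightarrow> g x \<in> C"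
    "\<And>y. finite (g -` {y}) \<and> card (g -` {y}) \<le> d"
    using assms(2) unfolding bfo_le_def by blast
  have "finite ((\<lambda>x. g (f x)) -` {y}) \<and> card ((\<lambda>x. g (f x)) -` {y}) \<le> d * c" for y
  proof -
    have eq: "(\<lambda>x. g (f x)) -` {y} = (\<Union>z\<in>g -` {y}. f -` {z})" by auto
    have "card (\<Union>z\<in>g -` {y}. f -` {z}) \<le> (\<Sum>z\<in>g -` {y}. card (f -` {z}))"
      using g(4) by (intro card_UN_le) blast
    also have "\<dots> \<le> card (g -` {y}) * c"
      using sum_bounded_above[of "g -` {y}" "\<lambda>z. card (f -` {z})" c] f(4) by simp
    also have "\<dots> \<le> d * c" using g(4) by simp
    finally show ?thesis using f(4) g(4) unfolding eq by auto
  qed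
  moreover have "1 \<le> d * c" using f(2) g(2) by (simp add: Suc_le_eq)
  moreover have "computable (\<lambda>x. g (f x))"
    using f(1) g(1) unfolding computable_iff by (rule computable_in_comp[rotated])
  ultimately show ?thesis unfolding bfo_le_def using f(3) g(3) by blast
qed

text \<open>\<open>one_degree_le\<close> asks for some pair of representatives only; transitivity
  carries the relation over to the given ones.\<close>

lemma one_degree_le_iff:
  "one_degree_le ({(X, Y). X \<equiv>\<^sub>1 Y} `` {A}) ({(X, Y). X \<equiv>\<^sub>1 Y} `` {B}) \<longleftrightarrow> A \<le>\<^sub>1 B"
proof
  assume "one_degree_le ({(X, Y). X \<equiv>\<^sub>1 Y} `` {A}) ({(X, Y). X \<equiv>\<^sub>1 Y} `` {B})"
  then obtain X Y where "A \<le>\<^sub>1 X" "X \<le>\<^sub>1 Y" "Y \<le>\<^sub>1 B"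
    unfolding one_degree_le_def one_equiv_def by auto
  then show "A \<le>\<^sub>1 B" by (meson one_le_trans)
next
  assume "A \<le>\<^sub>1 B"
  then show "one_degree_le ({(X, Y). X \<equiv>\<^sub>1 Y} `` {A}) ({(X, Y). X \<equiv>\<^sub>1 Y} `` {B})"
    unfolding one_degree_le_def one_equiv_def
    by (intro bexI[of _ A] bexI[of _ B]) (simp_all add: one_le_refl)
qed

lemma one_degree_inside:
  assumes "B \<equiv>\<^sub>b\<^sub>f\<^sub>o A"
  shows "{(X, Y). X \<equiv>\<^sub>1 Y} `` {B} \<in> one_degrees_inside A"
proof -
  have "{(X, Y). X \<equiv>\<^sub>1 Y} `` {B} \<in> one_degrees"
    unfolding one_degrees_def by (rule quotientI) (rule UNIV_I)
  moreover have "{(X, Y). X \<equiv>\<^sub>1 Y} `` {B} \<subseteq> bfo_degree A"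
  proof
    fix X assume "X \<in> {(X, Y). X \<equiv>\<^sub>1 Y} `` {B}"
    then have 1: "X \<le>\<^sub>1 B" "B \<le>\<^sub>1 X" by (simp_all add: one_equiv_def)
    have 2: "A \<le>\<^sub>b\<^sub>f\<^sub>o B" "B \<le>\<^sub>b\<^sub>f\<^sub>o A" using assms by (simp_all add: bfo_equiv_def)
    have "X \<le>\<^sub>b\<^sub>f\<^sub>o A" "A \<le>\<^sub>b\<^sub>f\<^sub>o X"
      using bfo_le_trans[OF one_le_imp_bfo_le[OF 1(1)] 2(2)]
        bfo_le_trans[OF 2(1) one_le_imp_bfo_le[OF 1(2)]] .
    then show "X \<in> bfo_degree A" by (simp add: bfo_degree_def bfo_equiv_def)
  qed
  ultimately show ?thesis unfolding one_degrees_inside_def by simp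
qed

section \<open>Lengths of constant profiles\<close>

definition block_length :: "rat \<Rightarrow> nat \<Rightarrow> nat" where
  "block_length r k = nat \<lfloor>r * fact k\<rfloor>"

lemma block_length_mono: "r \<le> r' \<Longrightarrow> block_length r k \<le> block_length r' k"
  unfolding block_length_def by (intro nat_mono floor_mono mult_right_mono) auto

lemma block_length_lower: "1 \<le> r \<Longrightarrow> fact k \<le> block_length r k"
  by (simp add: block_length_def le_nat_iff le_floor_iff)

lemma block_length_upper:
  assumes "r \<le> 2" shows "block_length r k \<le> 2 * fact k"
proof -
  have "r * fact k \<le> 2 * fact k" using assms by (rule mult_right_mono) simp
  then have "r * fact k < 2 * fact k + 1" by linarith
  then show ?thesis by (simp add: block_length_def nat_le_iff floor_le_iff)
qed

text \<open>Inductively the earlier factorials sum to at most twice the previous one, which is at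
  most the new one except in the smallest case, checked directly.\<close>

lemma start_fact_le: "start fact (Suc k) \<le> 2 * fact k"
proof (induction k)
  case (Suc k)
  then show ?case by (cases k) (auto simp: start_Suc start_def)
qed (simp add: start_def)

text \<open>With \<open>k = Suc m\<close>, the unrounded lengths of the two \<open>k\<close>-th
  blocks differ by \<open>(r - r') * Suc m * fact m\<close>, while the earlier blocks total at most
  \<open>4 * fact m\<close>; the factor \<open>Suc m\<close> wins eventually.\<close>

lemma block_length_large:
  assumes "1 < r'" "r' < r" "r < 2"
  shows "\<exists>n. \<forall>k\<ge>n. start (block_length r') (Suc k) < block_length r k"
proof -
  \<comment> \<open>The 5 pays for \<open>4 * fact m\<close> from the earlier blocks and one further
    \<open>fact m\<close> that absorbs the rounding.\<close>
  obtain n where n: "5 / (r - r') < of_nat n" using reals_Archimedean2 by blast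
  have "start (block_length r') (Suc k) < block_length r k" if k: "Suc n \<le> k" for k
  proof -
    obtain m where m: "k = Suc m" "n \<le> m" using k by (cases k) auto
    have pos: "0 < r - r'" using assms by simp
    have "5 < (r - r') * of_nat n" using n pos by (simp add: field_simps)
    also have "\<dots> \<le> (r - r') * of_nat (Suc m)"
      using m(2) pos by (intro mult_left_mono) (simp_all del: of_nat_Suc)
    finally have "5 * fact m \<le> (r - r') * of_nat (Suc m) * fact m"
      by (intro mult_right_mono) auto
    then have gap: "5 * fact m \<le> r * fact k - r' * fact k" by (simp add: m(1) algebra_simps)
    have "start (block_length r') k \<le> start (\<lambda>k. 2 * fact k) k"
      by (rule start_pointwise_mono) (use assms block_length_upper in auto)
    also have "\<dots> = 2 * start fact k" by (simp add: start_def sum_distrib_left)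
    also have "\<dots> \<le> 4 * fact m" using start_fact_le[of m] by (simp add: m(1))
    finally have "of_nat (start (block_length r') k) \<le> (of_nat (4 * fact m) :: rat)"
      by (simp only: of_nat_le_iff)
    then have a: "of_nat (start (block_length r') k) \<le> (4 * fact m :: rat)" by simp
    have bl: "of_nat (block_length s k) = (of_int \<lfloor>s * fact k\<rfloor> :: rat)" if "1 < s" for s
      unfolding block_length_def using that by simp
    have "of_nat (block_length r' k) \<le> r' * fact k" using bl[of r'] assms by simp
    moreover have "r * fact k < of_nat (block_length r k) + 1" using bl[of r] assms by linarith
    moreover have "(1::rat) \<le> fact m" by simp
    ultimately have "of_nat (start (block_length r') (Suc k)) < (of_nat (block_length r k) :: rat)"
      using a gap unfolding start_Suc of_nat_add by linarith
    then show ?thesis by (simp only: of_nat_less_iff)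
  qed
  then show ?thesis by blast
qed

text \<open>Clearing denominators turns the floor into a least-number search with natural-number
  arithmetic only.\<close>

lemma computable_block_length:
  assumes "computable (\<lambda>i. rat_code (q i))" "\<And>i. 1 < q i"
  shows "computable_in {} (\<lambda>z. block_length (q (pi1 z)) (pi2 z))"
proof -
  text \<open>The numerator and denominator are positive, and \<^const>\<open>int_encode\<close> doubles a nonnegative
    integer; the factors 2 cancel.\<close>
  define a where "a i = pi1 (rat_code (q i))" for i
  define b where "b i = pi2 (rat_code (q i))" for i
  have ab: "0 < b i \<and> of_nat (a i) = q i * of_nat (b i)" for i
  proof -
    obtain m n where mn: "quotient_of (q i) = (m, n)" by fastforce
    have n: "0 < n" and q: "q i = of_int m / of_int n"
      using quotient_of_denom_pos[OF mn] quotient_of_div[OF mn] by auto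
    have "0 < q i" using assms(2)[of i] by simp
    then have "0 < m" using n q by (simp add: zero_less_divide_iff)
    then have "a i = 2 * nat m" "b i = 2 * nat n"
      using n by (auto simp: a_def b_def rat_code_def mn int_encode_def sum_encode_def)
    then show ?thesis using n q \<open>0 < m\<close> by simp
  qed
  \<comment> \<open>The floor of a nonnegative number is the least \<open>n\<close> for which the
    number is below \<open>Suc n\<close>; both sides are multiplied by the denominator.\<close>
  have len: "block_length (q i) k = (LEAST n. a i * fact k < Suc n * b i)" for i k
  proof (rule Least_equality[symmetric])
    have iff: "a i * fact k < Suc n * b i \<longleftrightarrow> q i * fact k < of_nat (Suc n)" for n
    proof -
      have "a i * fact k < Suc n * b i \<longleftrightarrow>
          (of_nat (a i * fact k) :: rat) < of_nat (Suc n * b i)" by (simp only: of_nat_less_iff)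
      also have "\<dots> \<longleftrightarrow> of_nat (b i) * (q i * fact k) < of_nat (b i) * of_nat (Suc n)"
        using ab[of i] by (simp add: algebra_simps)
      also have "\<dots> \<longleftrightarrow> q i * fact k < of_nat (Suc n)" using ab[of i] by simp
      finally show ?thesis .
    qed
    have nonneg: "0 \<le> q i * fact k" using assms(2)[of i] by simp
    show "a i * fact k < Suc (block_length (q i) k) * b i"
      unfolding iff block_length_def using nonneg by simp linarith
    show "block_length (q i) k \<le> n" if "a i * fact k < Suc n * b i" for n
      using that unfolding iff block_length_def by (simp add: nat_le_iff floor_le_iff)
  qed
  have c: "computable_in {} (\<lambda>x. rat_code (q x))" using assms(1) by (simp add: computable_iff)
  show ?thesis
    unfolding len
  proof (rule computable_in_Least)
    show "computable_in {} (\<lambda>z. of_bool (a (pi1 (pi1 z)) * fact (pi2 (pi1 z)) < Suc (pi2 z) * b (pi1 (pi1 z))))"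
      unfolding a_def b_def by (intro comp_intros computable_in_comp[OF c])
    fix x
    \<comment> \<open>The numerator itself bounds the search, since the denominator is at least
      1.\<close>
    have "a (pi1 x) * fact (pi2 x) < Suc (a (pi1 x) * fact (pi2 x)) * b (pi1 x)"
      using ab[of "pi1 x"] by (cases "b (pi1 x)") auto
    then show "\<exists>n. a (pi1 x) * fact (pi2 x) < Suc n * b (pi1 x)" by blast
  qed
qed

text \<open>The map \<open>x / (1 + \<bar>x\<bar>)\<close> squashes the rationals increasingly into
  the interval from -1 to 1, and an affine map moves this to the interval from 1 to 2.\<close>

lemma rat_embeds_in_interval:
  obtains g :: "rat \<Rightarrow> rat" where "strict_mono g" "range g \<subseteq> {1<..<2}"
proof -
  define g :: "rat \<Rightarrow> rat" where "g x = (3 + x / (1 + \<bar>x\<bar>)) / 2" for x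
  have "g x < g y" if "x < y" for x y
  proof -
    have "x * (1 + \<bar>y\<bar>) < y * (1 + \<bar>x\<bar>)"
    \<comment> \<open>With equal signs the product terms cancel; otherwise \<open>x < 0\<close> and
      \<open>0 < y\<close>.\<close>
    proof (cases "0 \<le> x \<or> y \<le> 0")
      case True
      then show ?thesis using that by (auto simp: algebra_simps abs_if)
    next
      case False
      then have "x * (1 + \<bar>y\<bar>) < 0" "0 < y * (1 + \<bar>x\<bar>)"
        by (auto simp: mult_less_0_iff add_pos_nonneg)
      then show ?thesis by linarith
    qed
    then have "x / (1 + \<bar>x\<bar>) < y / (1 + \<bar>y\<bar>)"
      by (simp add: divide_less_eq less_divide_eq add_pos_nonneg field_simps)
    then show ?thesis
      unfolding g_def by (intro divide_strict_right_mono add_strict_left_mono) simp_all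
  qed
  moreover have "1 < g x \<and> g x < 2" for x
    unfolding g_def by (auto simp: field_simps abs_if)
  ultimately show thesis by (intro that[of g]) (auto simp: strict_mono_def)
qed

section \<open>The coding for constant profiles and the copy of the rational order\<close>

theorem corollary3p4:
  fixes q :: "nat \<Rightarrow> rat" and u :: "nat \<Rightarrow> nat \<Rightarrow> rat" and D :: "(nat \<times> nat) set"
  assumes "inj q" and "range q = {1<..<2}" and "computable (\<lambda>i. rat_code (q i))"
    and "\<And>i k. u i k = q i"
    and "D = {(i, j). q i > q j}"
  shows "\<exists>(A :: nat set) (h :: nat \<Rightarrow> nat \<Rightarrow> nat) (B :: rat \<Rightarrow> nat set).
    A \<le>\<^sub>T jump {} \<and>
    uniformly_computable h \<and>
    (\<forall>i. surj (h i)) \<and>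
    profile_coding u D A h \<and>
    (\<forall>i. B (q i) = h i -` A) \<and>
    (\<forall>i. B (q i) \<equiv>\<^sub>b\<^sub>f\<^sub>o A) \<and>
    (\<forall>i j. B (q i) <\<^sub>1 B (q j) \<longleftrightarrow> q i < q j) \<and>
    contains_copy (one_degrees_inside A) one_degree_le (UNIV :: rat set) (\<le>)"
proof -
  have q: "1 < q i" "q i < 2" for i using assms(2) by (metis greaterThanLessThan_iff rangeI)+
  \<comment> \<open>As all lengths are at most \<open>2 * fact k\<close>, this bounds the end of the
    \<open>k\<close>-th block for every \<open>i\<close> at once, so one \<open>S\<close> serves all
    pairs.\<close>
  have "computable_in (jump {}) (\<lambda>k. 2 * start fact (Suc k))" by (intro comp_intros)
  then obtain S where S: "computable_in (jump {}) (\<lambda>k. of_bool (k \<in> S))"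
    and sparse: "\<And>f n. computable f \<Longrightarrow> \<exists>k\<in>S. n \<le> k \<and>
      (\<forall>x\<le>2 * start fact (Suc k). \<forall>m. k < m \<and> m \<le> f x \<longrightarrow> m \<notin> S)"
    by (rule ex_sparse_set) blast
  define l where "l i = block_length (q i)" for i
  have lower: "fact k \<le> l i k" and upper: "l i k \<le> 2 * fact k" for i k
    using q[of i] by (simp_all add: l_def block_length_lower block_length_upper)
  have pos: "0 < l i k" for i k using length_pos lower upper .
  define A where "A = coded S fact"
  define h where "h i = fold_map (l i)" for i
  define B where "B r = h (inv q r) -` A" for r
  have lc: "computable_in {} (\<lambda>z. l (pi1 z) (pi2 z))"
    unfolding l_def using assms(3) q(1) by (rule computable_block_length)
  have li: "computable (l i)" for i
    unfolding computable_iff by (rule computable_in_comp2[OF lc]) (intro comp_intros)+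
  have hA: "h i -` A = coded S (l i)" for i
    unfolding h_def A_def by (rule vimage_fold_map) (rule lower upper)+
  have B: "B (q i) = coded S (l i)" for i
    unfolding B_def hA by (simp add: assms(1))
  have "computable_in (jump {}) (\<lambda>x. index fact x)"
    by (rule computable_in_index) (intro comp_intros fact_gt_zero)+
  then have "A \<le>\<^sub>T jump {}"
    unfolding turing_le_iff A_def coded_def using computable_in_comp[OF S] by simp
  moreover have unif: "uniformly_computable h"
  proof -
    have "computable_in {} (\<lambda>z. fold_map (l (pi1 z)) (pi2 z))"
      by (rule computable_in_fold_map) (intro comp_intros computable_in_comp2[OF lc] pos)+
    then show ?thesis
      by (simp add: uniformly_computable_def h_def computable_iff case_prod_beta)
  qed
  moreover have "\<forall>i. surj (h i)"
    unfolding h_def by (intro allI surj_fold_map lower upper)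
  moreover have fibre: "finite (h i -` {y}) \<and> card (h i -` {y}) \<le> 2" for i y
    unfolding h_def by (intro fold_map_fibre lower upper)
  moreover have bfo: "coded S (l i) \<equiv>\<^sub>b\<^sub>f\<^sub>o A" for i
  proof -
    have "computable (h i)"
      using unif computable_in_comp2[of "{}" h "\<lambda>_. i" "\<lambda>x. x"]
      by (auto simp: uniformly_computable_def computable_iff case_prod_beta intro: comp_intros)
    then have "h i -` A \<le>\<^sub>b\<^sub>f\<^sub>o A"
      unfolding bfo_le_def using fibre[of i] by (intro exI[of _ "h i"] exI[of _ 2]) auto
    \<comment> \<open>\<open>A\<close> is itself a coded set, with the factorials as lengths, and
      these never exceed \<open>l i\<close>.\<close>
    moreover have "A \<le>\<^sub>1 coded S (l i)"
      unfolding A_def by (rule coded_one_le) (auto simp: computable_iff li[unfolded computable_iff]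
          intro: lower comp_intros)
    ultimately show ?thesis by (simp add: hA bfo_equiv_def one_le_imp_bfo_le)
  qed
  moreover have le: "coded S (l i) \<le>\<^sub>1 coded S (l j)" if "q i \<le> q j" for i j
    by (rule coded_one_le) (use that li pos in \<open>auto simp: l_def block_length_mono\<close>)
  moreover have not_le: "\<not> coded S (l i) \<le>\<^sub>1 coded S (l j)" if less: "q j < q i" for i j
  proof -
    obtain n where "\<And>k. n \<le> k \<Longrightarrow> start (l j) (Suc k) < l i k"
      using block_length_large[OF q(1) less q(2)] unfolding l_def by blast
    moreover have "start (l i) k \<le> 2 * start fact k" for k
      using start_pointwise_mono[of "l i" "\<lambda>k. 2 * fact k" k] upper
      by (simp add: start_def sum_distrib_left)
    ultimately show ?thesis using not_coded_one_le[OF sparse, of "l i" "l j"] pos by blast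
  qed
  moreover have "profile_coding u D A h"
    unfolding profile_coding_def is_profile_def hA
    using q fibre bfo le not_le by (auto simp: assms(4,5) block_eq A_def coded_def)
  moreover have "contains_copy (one_degrees_inside A) one_degree_le (UNIV :: rat set) (\<le>)"
  proof -
    obtain g :: "rat \<Rightarrow> rat" where g: "strict_mono g" "range g \<subseteq> {1<..<2}"
      by (rule rat_embeds_in_interval)
    \<comment> \<open>The index at which the enumeration lists \<open>g r\<close>, which exists
      because \<open>g r\<close> lies in the range of \<open>q\<close>.\<close>
    define e where "e r = inv q (g r)" for r
    have e: "q (e r) = g r" for r
      unfolding e_def by (rule f_inv_into_f) (use g(2)[THEN subsetD, OF rangeI] assms(2) in simp)
    define F where "F r = {(X, Y). X \<equiv>\<^sub>1 Y} `` {coded S (l (e r))}" for r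
    have "F ` UNIV \<subseteq> one_degrees_inside A"
      unfolding F_def using one_degree_inside[OF bfo] by blast
    \<comment> \<open>The rational order is total, so reflection is the contrapositive given by
      \<open>not_le\<close>.\<close>
    moreover have "r \<le> s \<longleftrightarrow> one_degree_le (F r) (F s)" for r s
      unfolding F_def one_degree_le_iff
      using le[of "e r" "e s"] not_le[of "e s" "e r"] e strict_mono_less_eq[OF g(1)]
      by (metis not_less)
    ultimately show ?thesis unfolding contains_copy_def by blast
  qed
  moreover have "B (q i) <\<^sub>1 B (q j) \<longleftrightarrow> q i < q j" for i j
    unfolding B one_less_def using le not_le by (metis less_imp_le not_less)
  ultimately show ?thesis
    using B hA by (intro exI[of _ A] exI[of _ h] exI[of _ B]) simp
qed

end
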